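(* Let $m\ge 1$ be a fixed number of bins, let $v^*$ be the optimum stretching factor of online bin stretching with $m$ bins, and for each integer $n\ge 1$ let $\ell_n$ be the min-max value of the lower bound game with granularity $n$ and $m$ bins. For every integer $g\ge 1$, setting $$g'=\left\lceil g\left(1+\frac{m}{\sqrt g}+\frac1g\right)+\sqrt{g\left(1+\frac{m}{\sqrt g}+\frac1g\right)}\;\right\rceil,$$ the following inequality holds: $$\ell_{g'}\;\le\; v^*\;\le\;\left(\ell_{g'}+\frac{m\sqrt g+2}{g'}\right)\frac{g'}{g}.$$ Moreover, the sequence of lower bounds converges to the optimum: $\lim_{n\to+\infty}\ell_n=v^*$.
   Context: **Online bin stretching.** Fix an integer $m\ge 1$ (number of bins). An input is a finite sequence of items, each with a positive real size, such that the whole set of items can be partitioned into $m$ groups each of total size at most $1$ (i.e. it fits into $m$ bins of unit size). Let $\mathcal I$ be the set of all such inputs. A (deterministic) online algorithm $A$ is a sequence of functions $(A_1,A_2,\dots)$, where $A_i$ takes the first $i$ item sizes and outputs the index in $\{1,\dots,m\}$ of the bin into which the $i$-th item is irrevocably placed. There is no capacity limit on the bins used by the algorithm. Let $\mathcal A$ be the set of online algorithms. For $I\in\mathcal I$, $A(I)$ is the load (sum of item sizes) of the fullest bin after packing $I$ according to $A$. The stretching factor of $A$ is $r(A)=\sup_{I\in\mathcal I}A(I)$, and the optimum stretching factor is $v^*=\inf_{A\in\mathcal A}r(A)$. **Lower bound game with granularity $n\in\mathbb N^*$ and $m$ bins.** This is a two-player zero-sum perfect-information game between the adversary (maximizer)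 and the algorithm (minimizer). In each round the adversary sends an item whose size lies in $\{\frac1n,\frac2n,\dots,1\}$, subject to the constraint that the sequence of all items sent so far fits into $m$ bins of size $1$; the algorithm then places the item into one of the $m$ bins of its choice. This is repeated until the adversary can no longer send an item. The score is the load of the fullest bin. The number $\ell_n$ is the min-max value of this game. *)

theory Defs
  imports Complex_Main
begin

text \<open>
  A packing of the items \<open>xs\<close> is the list \<open>bs\<close> (of the same length) of bin indices in \<open>{1..m}\<close>:
  item \<open>xs ! i\<close> lies in bin \<open>bs ! i\<close>.
\<close>

definition bin_load :: "real list \<Rightarrow> nat list \<Rightarrow> nat \<Rightarrow> real" where
  "bin_load xs bs j = (\<Sum>i | i < length xs \<and> bs ! i = j. xs ! i)"

definition max_load :: "nat \<Rightarrow> real list \<Rightarrow> nat list \<Rightarrow> real" where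
  "max_load m xs bs = (MAX j\<in>{1..m}. bin_load xs bs j)"

definition fits :: "nat \<Rightarrow> real list \<Rightarrow> bool" where
  "fits m xs \<longleftrightarrow> (\<exists>bs. length bs = length xs \<and> set bs \<subseteq> {1..m} \<and> (\<forall>j\<in>{1..m}. bin_load xs bs j \<le> 1))"

lemma sum_bin_load:
  assumes "length bs = length xs" "set bs \<subseteq> {1..m}"
  shows "(\<Sum>j\<in>{1..m}. bin_load xs bs j) = sum_list xs"
proof -
  have "sum_list xs = (\<Sum>i<length xs. xs ! i)"
    by (simp add: sum_list_sum_nth atLeast0LessThan)
  also have "\<dots> = (\<Sum>j\<in>{1..m}. \<Sum>i | i \<in> {..<length xs} \<and> bs ! i = j. xs ! i)"
    using assms by (intro sum.group[symmetric]) (auto simp: subset_iff in_set_conv_nth)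
  finally show ?thesis
    by (simp add: bin_load_def)
qed

lemma fits_sum_list_le:
  assumes "fits m xs"
  shows "sum_list xs \<le> real m"
proof -
  obtain bs where "length bs = length xs" "set bs \<subseteq> {1..m}" "\<forall>j\<in>{1..m}. bin_load xs bs j \<le> 1"
    using assms unfolding fits_def by blast
  then have "sum_list xs = (\<Sum>j\<in>{1..m}. bin_load xs bs j)" "\<forall>j\<in>{1..m}. bin_load xs bs j \<le> 1"
    using sum_bin_load by auto
  then show ?thesis
    using sum_bounded_above[of "{1..m}" "bin_load xs bs" 1] by simp
qed

section \<open>Online bin stretching\<close>

definition inputs :: "nat \<Rightarrow> real list set" where
  "inputs m = {xs. (\<forall>x\<in>set xs. 0 < x) \<and> fits m xs}"

text \<open>
  An online algorithm \<open>(A\<^sub>1, A\<^sub>2, \<dots>)\<close> is a single function on nonempty lists: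
  \<open>A\<^sub>i\<close> is its restriction to lists of length \<open>i\<close>.
\<close>

definition online_algorithms :: "nat \<Rightarrow> (real list \<Rightarrow> nat) set" where
  "online_algorithms m = {A. \<forall>xs. xs \<noteq> [] \<longrightarrow> A xs \<in> {1..m}}"

definition packing_of :: "(real list \<Rightarrow> nat) \<Rightarrow> real list \<Rightarrow> nat list" where
  "packing_of A xs = map (\<lambda>i. A (take (Suc i) xs)) [0..<length xs]"

definition alg_load :: "nat \<Rightarrow> (real list \<Rightarrow> nat) \<Rightarrow> real list \<Rightarrow> real" where
  "alg_load m A xs = max_load m xs (packing_of A xs)"

definition stretching_factor :: "nat \<Rightarrow> (real list \<Rightarrow> nat) \<Rightarrow> real" where
  "stretching_factor m A = (SUP xs\<in>inputs m. alg_load m A xs)"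

definition opt_stretching :: "nat \<Rightarrow> real" where
  "opt_stretching m = (INF A\<in>online_algorithms m. stretching_factor m A)"

text \<open>
  For \<open>m \<ge> 1\<close> the real-valued supremum and infimum above are the true ones:
  they range over nonempty bounded sets.
\<close>

lemma Nil_in_inputs: "[] \<in> inputs m"
  by (simp add: inputs_def fits_def bin_load_def)

lemma alg_load_bounds:
  assumes "m \<ge> 1" "xs \<in> inputs m"
  shows "0 \<le> alg_load m A xs" "alg_load m A xs \<le> real m"
proof -
  let ?f = "bin_load xs (packing_of A xs)"
  have pos: "\<And>i. i < length xs \<Longrightarrow> 0 \<le> xs ! i"
    using assms(2) by (auto simp: inputs_def intro: less_imp_le)
  have nonneg: "0 \<le> ?f j" for j
    unfolding bin_load_def by (intro sum_nonneg) (use pos in auto)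
  have le: "?f j \<le> real m" for j
  proof -
    have "?f j \<le> (\<Sum>i<length xs. xs ! i)"
      unfolding bin_load_def by (intro sum_mono2) (use pos in auto)
    also have "\<dots> = sum_list xs"
      by (simp add: sum_list_sum_nth atLeast0LessThan)
    finally show ?thesis
      using fits_sum_list_le[of m xs] assms(2) by (simp add: inputs_def)
  qed
  have "alg_load m A xs \<in> ?f ` {1..m}"
    unfolding alg_load_def max_load_def using assms(1) by (intro Max_in) auto
  then show "0 \<le> alg_load m A xs" "alg_load m A xs \<le> real m"
    using nonneg le by auto
qed

lemma bdd_above_alg_load:
  assumes "m \<ge> 1"
  shows "bdd_above (alg_load m A ` inputs m)"
  using alg_load_bounds[OF assms] by (auto intro!: bdd_aboveI[of _ "real m"])

lemma online_algorithms_nonempty: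
  assumes "m \<ge> 1"
  shows "online_algorithms m \<noteq> {}"
proof -
  have "(\<lambda>_. 1) \<in> online_algorithms m"
    using assms by (simp add: online_algorithms_def)
  then show ?thesis by blast
qed

lemma bdd_below_stretching_factor:
  assumes "m \<ge> 1"
  shows "bdd_below (stretching_factor m ` online_algorithms m)"
proof (rule bdd_belowI[of _ 0])
  fix r assume "r \<in> stretching_factor m ` online_algorithms m"
  then obtain A where r: "r = stretching_factor m A" by blast
  have "alg_load m A [] \<le> r"
    unfolding r stretching_factor_def
    by (rule cSUP_upper[OF Nil_in_inputs bdd_above_alg_load[OF assms]])
  then show "0 \<le> r"
    using alg_load_bounds(1)[OF assms Nil_in_inputs, of A] by linarith
qed

section \<open>The lower bound game\<close>

definition legal_items :: "nat \<Rightarrow> nat \<Rightarrow> real list \<Rightarrow> real set" where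
  "legal_items m n xs = {x. (\<exists>k\<in>{1..n}. x = real k / real n) \<and> fits m (xs @ [x])}"

lemma finite_legal_items: "finite (legal_items m n xs)"
  by (rule finite_subset[of _ "(\<lambda>k. real k / real n) ` {1..n}"]) (auto simp: legal_items_def)

text \<open>
  The min-max value of the position reached after the items \<open>xs\<close> have been sent and placed
  according to \<open>bs\<close>, by backward induction on the (finite) game tree.
\<close>

function game_value :: "nat \<Rightarrow> nat \<Rightarrow> real list \<Rightarrow> nat list \<Rightarrow> real" where
  "game_value m n xs bs =
     (if legal_items m n xs = {} then max_load m xs bs
      else (MAX x\<in>legal_items m n xs. MIN b\<in>{1..m}. game_value m n (xs @ [x]) (bs @ [b])))"
  by pat_completeness auto
termination
proof (relation "measure (\<lambda>(m, n, xs, bs). nat \<lfloor>real n * (real m - sum_list xs)\<rfloor>)", goal_cases)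
  case 1
  then show ?case by simp
next
  case (2 m n xs bs x b)
  then obtain k where k: "k \<in> {1..n}" "x = real k / real n" and f: "fits m (xs @ [x])"
    by (auto simp: legal_items_def)
  have nx: "real n * x \<ge> 1"
    using k by auto
  have "real n * (real m - sum_list (xs @ [x])) \<ge> 0"
    using fits_sum_list_le[OF f] by simp
  moreover have "real n * (real m - sum_list xs) \<ge> real n * (real m - sum_list (xs @ [x])) + 1"
    using nx by (simp add: algebra_simps)
  ultimately have "nat \<lfloor>real n * (real m - sum_list (xs @ [x]))\<rfloor> < nat \<lfloor>real n * (real m - sum_list xs)\<rfloor>"
    by linarith
  then show ?case by simp
qed

declare game_value.simps [simp del]

definition lower_bound :: "nat \<Rightarrow> nat \<Rightarrow> real" where
  "lower_bound m n = game_value m n [] []"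

end

theory Submission
  imports Defs "HOL-Library.Multiset" "HOL-Real_Asymp.Real_Asymp"
begin

text \<open>
  The bound \<open>\<ell>\<^sub>n \<le> v\<^sup>*\<close> holds because every online algorithm is a strategy in the game.

  Conversely, let \<open>g > 0\<close> be real with \<open>g + \<surd>g + 1 \<le> n\<close>, scale the sizes so that the unit bins get
  capacity \<open>g\<close>, and let the algorithm play a shadow game with integer items and bins of capacity
  \<open>n\<close>. An item larger than \<open>\<surd>g\<close> is rounded up to an integer and sent to the game, whose optimal
  answer is copied. Smaller items are sand: a sand item goes to any bin whose real load does not
  exceed its load in the game, and as long as there is no such bin, items of size 1 are sent to the
  game. These are sent only while the real total exceeds the total in the game, so their number is
  at most the amount of sand plus one. As a bin of capacity \<open>g\<close> holds at most \<open>\<surd>g\<close> large items,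
  the items sent always fit into bins of capacity \<open>n\<close>. Real loads exceed game loads by at most one
  sand item, so \<open>v\<^sup>* g \<le> \<ell>\<^sub>n n + \<surd>g\<close>. The limit follows with \<open>g = n - \<surd>n - 1\<close>.
\<close>

section \<open>Loads and packings\<close>

lemma bin_load_snoc:
  assumes "length bs = length xs"
  shows "bin_load (xs @ [x]) (bs @ [b]) j = bin_load xs bs j + (if b = j then x else 0)"
proof -
  have "{i. i < length (xs @ [x]) \<and> (bs @ [b]) ! i = j}
      = {i. i < length xs \<and> bs ! i = j} \<union> (if b = j then {length xs} else {})"
    using assms by (auto simp: nth_append less_Suc_eq)
  then have "bin_load (xs @ [x]) (bs @ [b]) j
      = (\<Sum>i\<in>{i. i < length xs \<and> bs ! i = j} \<union> (if b = j then {length xs} else {}). (xs @ [x]) ! i)"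
    by (simp add: bin_load_def)
  also have "\<dots> = (\<Sum>i | i < length xs \<and> bs ! i = j. (xs @ [x]) ! i) + (if b = j then x else 0)"
    by (subst sum.union_disjoint) auto
  also have "(\<Sum>i | i < length xs \<and> bs ! i = j. (xs @ [x]) ! i) = bin_load xs bs j"
    unfolding bin_load_def by (intro sum.cong) (auto simp: nth_append)
  finally show ?thesis .
qed

lemma bin_load_le_max_load:
  "j \<in> {1..m} \<Longrightarrow> bin_load xs bs j \<le> max_load m xs bs"
  unfolding max_load_def by (intro Max_ge) auto

lemma max_load_le_iff:
  "m \<ge> 1 \<Longrightarrow> max_load m xs bs \<le> c \<longleftrightarrow> (\<forall>j\<in>{1..m}. bin_load xs bs j \<le> c)"
  unfolding max_load_def by (subst Max_le_iff) auto

text \<open>Together with its converse this replaces index lists by a splitting of the multiset of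
  items, so that feasibility no longer depends on the order of arrival. The induction adds the last
  item to the part of its bin.\<close>

lemma partition_of_packing:
  assumes "length bs = length xs" "set bs \<subseteq> {1..m}"
  shows "\<exists>B. mset xs = (\<Sum>j\<in>{1..m}. B j) \<and> (\<forall>j. sum_mset (B j) = bin_load xs bs j)"
  using assms
proof (induction xs arbitrary: bs rule: rev_induct)
  case Nil
  show ?case by (intro exI[of _ "\<lambda>_. {#}"]) (simp add: bin_load_def)
next
  case (snoc x xs)
  then obtain cs b where bs: "bs = cs @ [b]" "length cs = length xs"
    by (cases bs rule: rev_cases) auto
  then obtain B where B: "mset xs = (\<Sum>j\<in>{1..m}. B j)" "\<And>j. sum_mset (B j) = bin_load xs cs j"
    using snoc.IH[of cs] snoc.prems by auto
  have "b \<in> {1..m}" using snoc.prems bs by auto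
  then have "(\<Sum>j\<in>{1..m}. B j + (if j = b then {#x#} else {#})) = mset (xs @ [x])"
    by (subst sum.distrib) (simp add: B(1) sum.delta)
  then show ?case
    by (intro exI[of _ "\<lambda>j. B j + (if j = b then {#x#} else {#})"])
       (auto simp: B(2) bs bin_load_snoc)
qed

text \<open>The last item of the list lies in some part \<open>B b\<close>; removing it there leaves
  a splitting of the shorter list, and \<open>b\<close> is the index to append.\<close>

lemma packing_of_partition:
  fixes xs :: "real list"
  assumes "mset xs = (\<Sum>j\<in>{1..m}. B j)"
  shows "\<exists>bs. length bs = length xs \<and> set bs \<subseteq> {1..m} \<and>
    (\<forall>j\<in>{1..m}. bin_load xs bs j = sum_mset (B j))"
  using assms
proof (induction xs arbitrary: B rule: rev_induct)
  case Nil
  then have "set_mset (\<Sum>j\<in>{1..m}. B j) = {}" by (simp flip: Nil)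
  then have "B j = {#}" if "j \<in> {1..m}" for j
    using that by (simp add: set_mset_sum)
  then show ?case by (simp add: bin_load_def)
next
  case (snoc x xs)
  have "x \<in># (\<Sum>j\<in>{1..m}. B j)"
    unfolding snoc.prems[symmetric] by simp
  then obtain b where b: "b \<in> {1..m}" "x \<in># B b"
    by (auto simp: set_mset_sum)
  define B' where "B' = B(b := B b - {#x#})"
  have B: "B j = B' j + (if j = b then {#x#} else {#})" for j
    using b by (simp add: B'_def)
  have "mset xs + {#x#} = (\<Sum>j\<in>{1..m}. B' j) + {#x#}"
    using snoc.prems b(1) unfolding B by (subst (asm) sum.distrib) (simp add: sum.delta)
  then obtain bs where bs: "length bs = length xs" "set bs \<subseteq> {1..m}"
      "\<And>j. j \<in> {1..m} \<Longrightarrow> bin_load xs bs j = sum_mset (B' j)"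
    using snoc.IH[of B'] by auto
  show ?case
    by (intro exI[of _ "bs @ [b]"]) (use bs b in \<open>auto simp: bin_load_snoc B\<close>)
qed

lemma fits_iff_partition:
  "fits m xs \<longleftrightarrow> (\<exists>B. mset xs = (\<Sum>j\<in>{1..m}. B j) \<and> (\<forall>j\<in>{1..m}. sum_mset (B j) \<le> 1))"
proof
  assume "fits m xs"
  then obtain bs where "length bs = length xs" "set bs \<subseteq> {1..m}" "\<forall>j\<in>{1..m}. bin_load xs bs j \<le> 1"
    unfolding fits_def by blast
  then show "\<exists>B. mset xs = (\<Sum>j\<in>{1..m}. B j) \<and> (\<forall>j\<in>{1..m}. sum_mset (B j) \<le> 1)"
    using partition_of_packing[of bs xs m] by metis
next
  assume "\<exists>B. mset xs = (\<Sum>j\<in>{1..m}. B j) \<and> (\<forall>j\<in>{1..m}. sum_mset (B j) \<le> 1)"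
  then obtain B where "mset xs = (\<Sum>j\<in>{1..m}. B j)" "\<forall>j\<in>{1..m}. sum_mset (B j) \<le> 1"
    by blast
  then show "fits m xs"
    using packing_of_partition[of xs B m] unfolding fits_def by metis
qed

text \<open>Dropping a positive item raises no load. Closure under prefixes is what lets an
  invariant be carried along an input item by item.\<close>

lemma inputs_butlast:
  assumes "xs @ [x] \<in> inputs m"
  shows "xs \<in> inputs m"
proof -
  have pos: "0 < x" using assms by (simp add: inputs_def)
  obtain cs where cs: "length cs = Suc (length xs)" "set cs \<subseteq> {1..m}"
      "\<forall>j\<in>{1..m}. bin_load (xs @ [x]) cs j \<le> 1"
    using assms by (auto simp: inputs_def fits_def)
  then obtain bs b where bs: "cs = bs @ [b]" "length bs = length xs"
    by (cases cs rule: rev_cases) auto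
  have "\<forall>j\<in>{1..m}. bin_load xs bs j \<le> 1"
    using cs(3) pos bs by (force simp: bin_load_snoc split: if_splits)
  then show ?thesis
    using assms cs(2) bs by (auto simp: inputs_def fits_def)
qed

lemma sum_mset_nonneg:
  fixes M :: "real multiset"
  shows "(\<And>x. x \<in># M \<Longrightarrow> 0 \<le> x) \<Longrightarrow> 0 \<le> sum_mset M"
  by (induction M) auto

lemma input_item_le_one:
  assumes "xs \<in> inputs m" "x \<in> set xs"
  shows "x \<le> 1"
proof -
  obtain B where B: "mset xs = (\<Sum>j\<in>{1..m}. B j)" "\<forall>j\<in>{1..m}. sum_mset (B j) \<le> 1"
    using assms(1) by (auto simp: inputs_def fits_iff_partition)
  have "x \<in># mset xs" using assms(2) by simp
  then obtain j where j: "j \<in> {1..m}" "x \<in># B j"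
    unfolding B(1) by (auto simp: set_mset_sum)
  have "0 \<le> y" if "y \<in># B j" for y
  proof -
    have "y \<in># mset xs" unfolding B(1) using that j(1) by (auto simp: set_mset_sum)
    then show ?thesis using assms(1) by (auto simp: inputs_def less_imp_le)
  qed
  then have "0 \<le> sum_mset (B j - {#x#})"
    by (intro sum_mset_nonneg) (auto dest: in_diffD)
  moreover have "sum_mset (B j) = x + sum_mset (B j - {#x#})"
    using arg_cong[OF insert_DiffM[OF j(2)], of sum_mset] by simp
  ultimately show ?thesis using B(2) j(1) by force
qed

section \<open>Online algorithms preserving an invariant\<close>

lemma packing_of_snoc: "packing_of A (xs @ [x]) = packing_of A xs @ [A (xs @ [x])]"
  by (simp add: packing_of_def)

lemma length_packing_of [simp]: "length (packing_of A xs) = length xs"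
  by (simp add: packing_of_def)

text \<open>An algorithm sees the items only, whereas the invariant also speaks of their placement.
  Since the choices are deterministic, the earlier placements can be recomputed from the earlier
  items.\<close>

lemma online_algorithm_of_invariant:
  assumes "m \<ge> 1" and "P [] []"
    and step: "\<And>xs ps x. P xs ps \<Longrightarrow> xs @ [x] \<in> inputs m \<Longrightarrow> \<exists>b\<in>{1..m}. P (xs @ [x]) (ps @ [b])"
  shows "\<exists>A\<in>online_algorithms m. \<forall>xs\<in>inputs m. P xs (packing_of A xs)"
proof -
  \<comment> \<open>Where no bin preserves \<open>P\<close>, any bin in \<open>{1..m}\<close> will
    do; this makes the resulting algorithm total.\<close>
  define Q where "Q xs ps b \<longleftrightarrow> b \<in> {1..m} \<and> ((\<exists>b\<in>{1..m}. P xs (ps @ [b])) \<longrightarrow> P xs (ps @ [b]))"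
    for xs ps b
  have ex: "\<exists>b. Q xs ps b" for xs ps
    using assms(1) unfolding Q_def by (cases "\<exists>b\<in>{1..m}. P xs (ps @ [b])") auto
  \<comment> \<open>Items arrive at the end of the list, so the recursion runs over the reversed
    list: \<open>x\<close> is the newest item and \<open>ps\<close> the packing of the earlier
    ones.\<close>
  define pk :: "real list \<Rightarrow> nat list" where
    "pk = rec_list [] (\<lambda>x rs ps. ps @ [SOME b. Q (rev rs @ [x]) ps b])"
  have pk_Nil: "pk [] = []"
    and pk_Cons: "pk (x # rs) = pk rs @ [SOME b. Q (rev rs @ [x]) (pk rs) b]" for x rs
    by (simp_all add: pk_def)
  have Q: "Q (rev rs @ [x]) (pk rs) (last (pk (x # rs)))" for x rs
    unfolding pk_Cons using someI_ex[OF ex] by simp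
  define A where "A xs = last (pk (rev xs))" for xs
  have packing: "packing_of A xs = pk (rev xs)" for xs
  proof (induction xs rule: rev_induct)
    case Nil
    show ?case by (simp add: packing_of_def pk_Nil)
  next
    case (snoc x xs)
    then show ?case by (simp add: packing_of_snoc A_def pk_Cons)
  qed
  have "A xs \<in> {1..m}" if "xs \<noteq> []" for xs
    using that Q[of "rev (butlast xs)" "last xs"] unfolding A_def Q_def
    by (cases xs rule: rev_cases) auto
  then have "A \<in> online_algorithms m"
    by (auto simp: online_algorithms_def)
  moreover have "P xs (packing_of A xs)" if "xs \<in> inputs m" for xs
    using that
  proof (induction xs rule: rev_induct)
    case Nil
    show ?case using assms(2) by (simp add: packing_of_def)
  next
    case (snoc x xs)
    then have "\<exists>b\<in>{1..m}. P (xs @ [x]) (packing_of A xs @ [b])"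
      by (intro step snoc.IH) (auto dest: inputs_butlast)
    then show ?case
      using Q[of "rev xs" x] by (simp add: Q_def packing pk_Cons)
  qed
  ultimately show ?thesis by blast
qed

section \<open>The game\<close>

lemma game_value_step:
  assumes "legal_items m n xs \<noteq> {}"
  shows "game_value m n xs bs
    = (MAX x\<in>legal_items m n xs. MIN b\<in>{1..m}. game_value m n (xs @ [x]) (bs @ [b]))"
  using assms by (subst game_value.simps) simp

text \<open>A bin attaining the minimum for \<open>x\<close> works, because the value is a maximum
  over all legal items. This is the optimal reply that the shadow game copies.\<close>

lemma game_value_response:
  assumes "m \<ge> 1" "x \<in> legal_items m n xs"
  shows "\<exists>b\<in>{1..m}. game_value m n (xs @ [x]) (bs @ [b]) \<le> game_value m n xs bs"
proof -
  let ?f = "\<lambda>b. game_value m n (xs @ [x]) (bs @ [b])"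
  have "Min (?f ` {1..m}) \<in> ?f ` {1..m}"
    using assms(1) by (intro Min_in) auto
  then obtain b where b: "b \<in> {1..m}" "?f b = Min (?f ` {1..m})" by auto
  have "?f b \<le> game_value m n xs bs"
    unfolding b(2) using assms(2)
    by (subst (2) game_value_step) (auto intro!: Max_ge simp: finite_legal_items)
  then show ?thesis using b(1) by blast
qed

text \<open>Loads only grow: continue with any legal item and an optimal reply until the game ends.
  Hence the value controls the loads at every position, also when the real input stops before the
  game does.\<close>

lemma max_load_le_game_value:
  assumes "m \<ge> 1" "length bs = length xs"
  shows "max_load m xs bs \<le> game_value m n xs bs"
  using assms
proof (induction m n xs bs rule: game_value.induct)
  case (1 m n xs bs)
  show ?case
  proof (cases "legal_items m n xs = {}")
    case True
    then show ?thesis by (subst game_value.simps) simp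
  next
    case False
    then obtain x where x: "x \<in> legal_items m n xs" by blast
    then obtain b where b: "b \<in> {1..m}" "game_value m n (xs @ [x]) (bs @ [b]) \<le> game_value m n xs bs"
      using game_value_response 1 by blast
    have "max_load m xs bs \<le> max_load m (xs @ [x]) (bs @ [b])"
      unfolding max_load_le_iff[OF 1(2)]
    proof
      fix j assume j: "j \<in> {1..m}"
      have "0 \<le> x" using x by (auto simp: legal_items_def)
      then have "bin_load xs bs j \<le> bin_load (xs @ [x]) (bs @ [b]) j"
        using 1 by (simp add: bin_load_snoc)
      then show "bin_load xs bs j \<le> max_load m (xs @ [x]) (bs @ [b])"
        using bin_load_le_max_load[OF j] order_trans by blast
    qed
    also have "\<dots> \<le> game_value m n (xs @ [x]) (bs @ [b])"
      using 1 False x b by simp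
    finally show ?thesis using b by simp
  qed
qed

text \<open>The answer of \<open>A\<close> is one candidate in each minimum, and the score at a leaf
  is the load of \<open>A\<close> on an input.\<close>

lemma game_value_le_stretching_factor:
  assumes "m \<ge> 1" "A \<in> online_algorithms m" "xs \<in> inputs m" "bs = packing_of A xs"
  shows "game_value m n xs bs \<le> stretching_factor m A"
  using assms
proof (induction m n xs bs rule: game_value.induct)
  case (1 m n xs bs)
  show ?case
  proof (cases "legal_items m n xs = {}")
    case True
    have "alg_load m A xs \<le> stretching_factor m A"
      unfolding stretching_factor_def using 1 by (intro cSUP_upper bdd_above_alg_load)
    then show ?thesis
      using True 1 by (subst game_value.simps) (simp add: alg_load_def)
  next
    case False
    have "(MIN b\<in>{1..m}. game_value m n (xs @ [x]) (bs @ [b])) \<le> stretching_factor m A"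
      if x: "x \<in> legal_items m n xs" for x
    proof -
      have b: "A (xs @ [x]) \<in> {1..m}" using 1 by (simp add: online_algorithms_def)
      have "xs @ [x] \<in> inputs m"
        using x 1 by (auto simp: legal_items_def inputs_def)
      then have "game_value m n (xs @ [x]) (bs @ [A (xs @ [x])]) \<le> stretching_factor m A"
        using 1 False x b by (simp add: packing_of_snoc)
      then show ?thesis
        using b by (intro order_trans[OF Min_le]) auto
    qed
    then show ?thesis
      unfolding game_value_step[OF False] using False
      by (subst Max_le_iff) (auto simp: finite_legal_items)
  qed
qed

lemma lower_bound_le_opt_stretching:
  assumes "m \<ge> 1"
  shows "lower_bound m n \<le> opt_stretching m"
  unfolding opt_stretching_def lower_bound_def
  using assms online_algorithms_nonempty
  by (intro cINF_greatest game_value_le_stretching_factor)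
     (auto simp: Nil_in_inputs packing_of_def)

section \<open>The shadow game\<close>

text \<open>The total is left unscaled, so it is \<open>g * sand g X\<close> that is compared with
  integer sizes.\<close>

definition sand :: "real \<Rightarrow> real multiset \<Rightarrow> real" where
  "sand g X = sum_mset (filter_mset (\<lambda>x. g * x \<le> sqrt g) X)"

definition large_size :: "real \<Rightarrow> real multiset \<Rightarrow> nat" where
  "large_size g X = (\<Sum>x\<in>#filter_mset (\<lambda>x. sqrt g < g * x) X. nat \<lceil>g * x\<rceil>)"

text \<open>All items sent to the game so far, of which \<open>V\<close> are unit fillers. A
  multiset suffices, as only feasibility is asked of it and the order of the units does not affect
  that.\<close>

definition shadow :: "nat \<Rightarrow> real \<Rightarrow> real multiset \<Rightarrow> nat \<Rightarrow> real multiset" where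
  "shadow n g X V = image_mset (\<lambda>x. real (nat \<lceil>g * x\<rceil>) / real n) (filter_mset (\<lambda>x. sqrt g < g * x) X)
     + replicate_mset V (1 / real n)"

lemma sand_union: "sand g (X + Y) = sand g X + sand g Y"
  by (simp add: sand_def)

lemma sand_sum: "finite J \<Longrightarrow> sand g (\<Sum>j\<in>J. B j) = (\<Sum>j\<in>J. sand g (B j))"
  by (induction J rule: finite_induct) (simp_all add: sand_union, simp add: sand_def)

lemma shadow_union: "shadow n g (X + Y) (V + W) = shadow n g X V + shadow n g Y W"
  by (simp add: shadow_def multiset_eq_iff)

lemma shadow_sum:
  "finite J \<Longrightarrow> shadow n g (\<Sum>j\<in>J. B j) (\<Sum>j\<in>J. c j) = (\<Sum>j\<in>J. shadow n g (B j) (c j))"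
  by (induction J rule: finite_induct) (simp_all add: shadow_union, simp add: shadow_def)

lemma sum_mset_shadow: "sum_mset (shadow n g X V) = real (large_size g X + V) / real n"
proof (induction X)
  case empty
  show ?case by (simp add: shadow_def large_size_def)
next
  case (add x X)
  then show ?case by (simp add: shadow_def large_size_def add_divide_distrib)
qed

lemma sum_mset_le_large_size: "g * sum_mset X \<le> real (large_size g X) + g * sand g X"
proof (induction X)
  case empty
  show ?case by (simp add: large_size_def sand_def)
next
  case (add x X)
  have "g * x \<le> real (nat \<lceil>g * x\<rceil>)" by linarith
  with add show ?case by (auto simp: large_size_def sand_def algebra_simps)
qed

text \<open>Rounding costs at most 1 per large item. Each of these has scaled size above
  \<open>sqrt g\<close> and together they have at most \<open>g\<close>, so there are at most
  \<open>sqrt g\<close> of them.\<close>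

lemma large_size_le:
  assumes "g > 0" "\<And>x. x \<in># X \<Longrightarrow> 0 < x" "sum_mset X \<le> 1"
  shows "real (large_size g X) + g * sand g X \<le> g + sqrt g"
proof -
  define k where "k = size (filter_mset (\<lambda>x. sqrt g < g * x) X)"
  \<comment> \<open>The bound 1 on the total is kept out of the induction;
    \<open>g * sum_mset X\<close> stands for \<open>g\<close>. The second conjunct counts the large
    items.\<close>
  have key: "real (large_size g X) + g * sand g X \<le> g * sum_mset X + real k \<and>
    sqrt g * real k \<le> g * sum_mset X"
    using assms(2) unfolding k_def
  proof (induction X)
    case empty
    show ?case by (simp add: large_size_def sand_def)
  next
    case (add x X)
    have "0 < g * x" using add.prems assms(1) by simp
    then have "real (nat \<lceil>g * x\<rceil>) \<le> g * x + 1" by linarith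
    with add \<open>0 < g * x\<close> show ?case by (auto simp: large_size_def sand_def algebra_simps)
  qed
  have "g * sum_mset X \<le> g"
    using assms by simp
  with key have le: "real (large_size g X) + g * sand g X \<le> g + real k"
    and "sqrt g * real k \<le> g"
    by linarith+
  then have "sqrt g * real k \<le> sqrt g * sqrt g"
    using assms(1) by simp
  then have "real k \<le> sqrt g"
    using assms(1) by (subst (asm) mult_le_cancel_left_pos) auto
  with le show ?thesis by linarith
qed

section \<open>Feasibility of the items sent to the game\<close>

text \<open>Greedy filling: one index takes as much as it can, and the remainder goes to the
  others.\<close>

lemma distribute_below_capacities:
  fixes cap :: "'a \<Rightarrow> nat"
  assumes "finite J" "V \<le> (\<Sum>j\<in>J. cap j)"
  shows "\<exists>c. (\<forall>j\<in>J. c j \<le> cap j) \<and> (\<Sum>j\<in>J. c j) = V"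
  using assms
proof (induction J arbitrary: V rule: finite_induct)
  case empty
  then show ?case by simp
next
  case (insert i J)
  define W where "W = min V (cap i)"
  have "V - W \<le> (\<Sum>j\<in>J. cap j)" using insert by (auto simp: W_def)
  then obtain c where c: "\<forall>j\<in>J. c j \<le> cap j" "(\<Sum>j\<in>J. c j) = V - W"
    using insert.IH by blast
  have "(\<Sum>j\<in>J. (c(i := W)) j) = V - W"
    using c(2) insert.hyps by (metis (mono_tags, lifting) fun_upd_other sum.cong)
  then show ?case
    using c(1) insert.hyps by (intro exI[of _ "c(i := W)"]) (auto simp: W_def)
qed

text \<open>Start from a partition of the real input. Rounded large items stay in their parts, and
  the units, which may be spread at will, fill the room left over.\<close>

lemma fits_shadow:
  assumes "m \<ge> 1" "g > 0" "g + sqrt g + 1 \<le> real n" "xs \<in> inputs m"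
    and V: "real V \<le> g * sand g (mset xs) + 1" and vs: "mset vs = shadow n g (mset xs) V"
  shows "fits m vs"
proof -
  obtain B where B: "mset xs = (\<Sum>j\<in>{1..m}. B j)" "\<forall>j\<in>{1..m}. sum_mset (B j) \<le> 1"
    using assms(4) by (auto simp: inputs_def fits_iff_partition)
  have pos: "0 < x" if "x \<in># B j" "j \<in> {1..m}" for x j
  proof -
    have "x \<in># mset xs" unfolding B(1) using that by (auto simp: set_mset_sum)
    then show ?thesis using assms(4) by (simp add: inputs_def)
  qed
  \<comment> \<open>The subtraction on naturals is not truncated, by the first claim of
    \<open>cap\<close>.\<close>
  define cap where "cap j = n - large_size g (B j)" for j
  have cap: "large_size g (B j) \<le> n" "g * sand g (B j) + 1 \<le> real (cap j)" if "j \<in> {1..m}" for j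
  proof -
    have le: "real (large_size g (B j)) + g * sand g (B j) \<le> g + sqrt g"
      using assms(2) pos that B(2) by (intro large_size_le) auto
    moreover have "0 \<le> sand g (B j)"
      unfolding sand_def using pos that by (intro sum_mset_nonneg) (auto simp: less_imp_le)
    then have "0 \<le> g * sand g (B j)" using assms(2) by simp
    ultimately have "real (large_size g (B j)) \<le> real n" using assms(3) by linarith
    then show "large_size g (B j) \<le> n" by simp
    then show "g * sand g (B j) + 1 \<le> real (cap j)"
      using le assms(3) by (simp add: cap_def of_nat_diff)
  qed
  \<comment> \<open>The bound on \<open>V\<close> has a single extra 1, while every one of the
    \<open>m \<ge> 1\<close> parts offers one.\<close>
  have "real V \<le> (\<Sum>j\<in>{1..m}. g * sand g (B j) + 1)"
    using V assms(1) unfolding B(1) by (simp add: sand_sum sum.distrib sum_distrib_left)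
  also have "\<dots> \<le> (\<Sum>j\<in>{1..m}. real (cap j))"
    using cap by (intro sum_mono)
  finally have "V \<le> (\<Sum>j\<in>{1..m}. cap j)"
    by (simp flip: of_nat_sum)
  then obtain c where c: "\<forall>j\<in>{1..m}. c j \<le> cap j" "(\<Sum>j\<in>{1..m}. c j) = V"
    using distribute_below_capacities[of "{1..m}" V cap] by auto
  have "sum_mset (shadow n g (B j) (c j)) \<le> 1" if "j \<in> {1..m}" for j
  proof -
    have "large_size g (B j) + c j \<le> n" using c(1) cap(1)[OF that] that by (force simp: cap_def)
    then have "real (large_size g (B j) + c j) \<le> real n" by (rule of_nat_mono)
    then show ?thesis unfolding sum_mset_shadow by (auto simp: divide_le_eq_1)
  qed
  then show ?thesis
    unfolding fits_iff_partition vs B(1) c(2)[symmetric]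
    by (intro exI[of _ "\<lambda>j. shadow n g (B j) (c j)"]) (simp add: shadow_sum)
qed

section \<open>The invariant linking the real packing to the game\<close>

text \<open>The bound on \<open>V\<close> is what \<open>fits_shadow\<close> needs. The factors
  \<open>g\<close> and \<open>real n\<close> bring real and game loads to a common scale, on which
  the slack \<open>sqrt g\<close> is the largest possible size of one sand item.\<close>

definition shadowed ::
  "nat \<Rightarrow> nat \<Rightarrow> real \<Rightarrow> real list \<Rightarrow> nat list \<Rightarrow> real list \<Rightarrow> nat list \<Rightarrow> nat \<Rightarrow> bool" where
  "shadowed m n g xs ps vs bs V \<longleftrightarrow>
     length ps = length xs \<and> set ps \<subseteq> {1..m} \<and> length bs = length vs \<and> set bs \<subseteq> {1..m} \<and>
     game_value m n vs bs \<le> lower_bound m n \<and>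
     mset vs = shadow n g (mset xs) V \<and> real V \<le> g * sand g (mset xs) + 1 \<and>
     (\<forall>j\<in>{1..m}. g * bin_load xs ps j \<le> real n * bin_load vs bs j + sqrt g)"

context
  fixes m n :: nat and g :: real
  assumes m: "m \<ge> 1" and g: "g > 0" and n: "g + sqrt g + 1 \<le> real n"
begin

lemma granularity_pos: "n \<ge> 1"
proof -
  have "0 < sqrt g" using g by simp
  then have "0 < real n" using g n by linarith
  then show ?thesis by simp
qed

text \<open>Summing \<open>ahead\<close> over the bins, the game total \<open>large_size + V\<close>
  is below the scaled real total, which is at most \<open>large_size\<close> plus the scaled sand.
  So \<open>V\<close> is below the scaled sand, and one more unit respects the bound on
  \<open>V\<close>.\<close>

lemma shadowed_send_unit:
  assumes "xs \<in> inputs m" and sh: "shadowed m n g xs ps vs bs V"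
    and ahead: "\<forall>j\<in>{1..m}. real n * bin_load vs bs j < g * bin_load xs ps j"
  shows "\<exists>vs' bs'. shadowed m n g xs ps vs' bs' (Suc V)"
proof -
  note sh' = sh[unfolded shadowed_def]
  have "real (large_size g (mset xs)) + real V = real n * sum_list vs"
    using granularity_pos sh' sum_mset_shadow[of n g "mset xs" V] by (simp flip: sum_mset_sum_list)
  also have "\<dots> = (\<Sum>j\<in>{1..m}. real n * bin_load vs bs j)"
    using sh' sum_bin_load[of bs vs m] by (simp flip: sum_distrib_left)
  also have "\<dots> < (\<Sum>j\<in>{1..m}. g * bin_load xs ps j)"
    using ahead m by (intro sum_strict_mono) auto
  also have "\<dots> = g * sum_list xs"
    using sh' sum_bin_load[of ps xs m] by (simp flip: sum_distrib_left)
  also have "\<dots> \<le> real (large_size g (mset xs)) + g * sand g (mset xs)"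
    using sum_mset_le_large_size[of g "mset xs"] by (simp add: sum_mset_sum_list)
  finally have V: "real (Suc V) \<le> g * sand g (mset xs) + 1" by simp
  have vs: "mset (vs @ [1 / real n]) = shadow n g (mset xs) (Suc V)"
    using sh' by (simp add: shadow_def)
  have "1 / real n \<in> legal_items m n vs"
    unfolding legal_items_def
    using fits_shadow[OF m g n assms(1) V vs] granularity_pos by (auto intro!: bexI[of _ 1])
  then obtain b where b: "b \<in> {1..m}"
      "game_value m n (vs @ [1 / real n]) (bs @ [b]) \<le> game_value m n vs bs"
    using game_value_response m by blast
  have "shadowed m n g xs ps (vs @ [1 / real n]) (bs @ [b]) (Suc V)"
    unfolding shadowed_def
  proof (intro conjI)
    show "\<forall>j\<in>{1..m}. g * bin_load xs ps j
        \<le> real n * bin_load (vs @ [1 / real n]) (bs @ [b]) j + sqrt g"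
    proof
      fix j assume "j \<in> {1..m}"
      then have "g * bin_load xs ps j \<le> real n * bin_load vs bs j + sqrt g" using sh' by blast
      then show "g * bin_load xs ps j \<le> real n * bin_load (vs @ [1 / real n]) (bs @ [b]) j + sqrt g"
        using sh' granularity_pos by (simp add: bin_load_snoc distrib_left)
    qed
  qed (use sh' b V vs in auto)
  then show ?thesis by blast
qed

text \<open>If the real load were ahead in every bin forever, units could be sent without end, but
  the invariant bounds \<open>V\<close> by a quantity fixed by \<open>xs\<close>.\<close>

lemma shadowed_catch_up:
  assumes "xs \<in> inputs m" "shadowed m n g xs ps vs bs V"
  shows "\<exists>vs bs V. shadowed m n g xs ps vs bs V \<and>
    (\<exists>j\<in>{1..m}. g * bin_load xs ps j \<le> real n * bin_load vs bs j)"
proof (rule ccontr)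
  assume neg: "\<not> ?thesis"
  \<comment> \<open>Starting from the given position, \<open>k\<close> units can be added, whatever
    \<open>k\<close> is.\<close>
  have "\<exists>vs bs W. k \<le> W \<and> shadowed m n g xs ps vs bs W" for k
  proof (induction k)
    case 0
    show ?case using assms(2) by blast
  next
    case (Suc k)
    then obtain vs bs W where W: "k \<le> W" "shadowed m n g xs ps vs bs W" by blast
    with neg have "\<forall>j\<in>{1..m}. real n * bin_load vs bs j < g * bin_load xs ps j"
      by (meson not_le)
    then show ?case
      using shadowed_send_unit[OF assms(1) W(2)] W(1) Suc_le_mono by blast
  qed
  then have "real k \<le> g * sand g (mset xs) + 1" for k
    unfolding shadowed_def by (metis of_nat_mono order_trans)
  then show False
    by (meson not_le reals_Archimedean2)
qed

text \<open>Sand is placed without a move in the game, after catching up. A large item is sent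
  rounded up, so under the copied reply the game load grows at least as much as the real
  one.\<close>

lemma shadowed_step:
  assumes x: "xs @ [x] \<in> inputs m" and "shadowed m n g xs ps vs bs V"
  shows "\<exists>b\<in>{1..m}. \<exists>vs bs V. shadowed m n g (xs @ [x]) (ps @ [b]) vs bs V"
proof (cases "g * x \<le> sqrt g")
  case True
  obtain vs bs V j where sh: "shadowed m n g xs ps vs bs V" and j: "j \<in> {1..m}"
      "g * bin_load xs ps j \<le> real n * bin_load vs bs j"
    using shadowed_catch_up[OF inputs_butlast[OF x] assms(2)] by blast
  note sh' = sh[unfolded shadowed_def]
  have "0 < g * x" using x g by (simp add: inputs_def)
  have "shadowed m n g (xs @ [x]) (ps @ [j]) vs bs V"
    unfolding shadowed_def
  proof (intro conjI)
    show "mset vs = shadow n g (mset (xs @ [x])) V"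
      using sh' True by (simp add: shadow_def)
    show "real V \<le> g * sand g (mset (xs @ [x])) + 1"
      using sh' True \<open>0 < g * x\<close> by (simp add: sand_def distrib_left)
    \<comment> \<open>Bin \<open>j\<close> had no excess before, so its excess is now at most
      \<open>g * x \<le> sqrt g\<close>; the other bins are unchanged.\<close>
    show "\<forall>i\<in>{1..m}. g * bin_load (xs @ [x]) (ps @ [j]) i \<le> real n * bin_load vs bs i + sqrt g"
      using sh' True j by (auto simp: bin_load_snoc distrib_left)
  qed (use sh' j in auto)
  then show ?thesis using j(1) by blast
next
  case False
  note sh' = assms(2)[unfolded shadowed_def]
  define v where "v = real (nat \<lceil>g * x\<rceil>) / real n"
  have "0 < g * x" using x g by (simp add: inputs_def)
  moreover have "g * x \<le> real n"
  proof -
    have "g * x \<le> g" using input_item_le_one[OF x] g by simp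
    then show ?thesis using n real_sqrt_gt_zero[OF g] by linarith
  qed
  \<comment> \<open>Rounding up cannot leave the range of sizes of the game, since \<open>n\<close>
    is itself an integer above \<open>g * x\<close>.\<close>
  ultimately have v: "nat \<lceil>g * x\<rceil> \<in> {1..n}"
    by (simp add: Suc_le_eq nat_le_iff ceiling_le_iff)
  have nv: "g * x \<le> real n * v" "0 \<le> real n * v"
    using granularity_pos unfolding v_def by (auto; linarith)+
  have V: "real V \<le> g * sand g (mset (xs @ [x])) + 1"
    using sh' False by (simp add: sand_def)
  have vs: "mset (vs @ [v]) = shadow n g (mset (xs @ [x])) V"
    using sh' False by (simp add: shadow_def v_def)
  have "v \<in> legal_items m n vs"
    unfolding legal_items_def using fits_shadow[OF m g n x V vs] v v_def by blast
  then obtain b where b: "b \<in> {1..m}"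
      "game_value m n (vs @ [v]) (bs @ [b]) \<le> game_value m n vs bs"
    using game_value_response m by blast
  have "shadowed m n g (xs @ [x]) (ps @ [b]) (vs @ [v]) (bs @ [b]) V"
    unfolding shadowed_def
  proof (intro conjI)
    show "\<forall>j\<in>{1..m}. g * bin_load (xs @ [x]) (ps @ [b]) j
        \<le> real n * bin_load (vs @ [v]) (bs @ [b]) j + sqrt g"
    proof
      fix j assume "j \<in> {1..m}"
      then have "g * bin_load xs ps j \<le> real n * bin_load vs bs j + sqrt g" using sh' by blast
      then show "g * bin_load (xs @ [x]) (ps @ [b]) j
          \<le> real n * bin_load (vs @ [v]) (bs @ [b]) j + sqrt g"
        using sh' nv by (simp add: bin_load_snoc distrib_left)
    qed
  qed (use sh' b V vs in auto)
  then show ?thesis using b(1) by blast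
qed

lemma opt_stretching_le_lower_bound:
  "opt_stretching m \<le> (lower_bound m n + sqrt g / real n) * (real n / g)"
proof -
  \<comment> \<open>The state of the game is hidden by quantifiers, leaving an invariant of items
    and placements alone.\<close>
  define P where "P xs ps \<longleftrightarrow> (\<exists>vs bs V. shadowed m n g xs ps vs bs V)" for xs ps
  have "shadowed m n g [] [] [] [] 0"
    using g by (simp add: shadowed_def shadow_def sand_def lower_bound_def bin_load_def)
  then have "P [] []" unfolding P_def by blast
  moreover have "\<exists>b\<in>{1..m}. P (xs @ [x]) (ps @ [b])" if "P xs ps" "xs @ [x] \<in> inputs m" for xs ps x
    using that shadowed_step unfolding P_def by metis
  ultimately obtain A where A: "A \<in> online_algorithms m" "\<And>xs. xs \<in> inputs m \<Longrightarrow> P xs (packing_of A xs)"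
    using online_algorithm_of_invariant[OF m, of P] by metis
  have "alg_load m A xs \<le> (lower_bound m n + sqrt g / real n) * (real n / g)" if xs: "xs \<in> inputs m" for xs
    unfolding alg_load_def max_load_le_iff[OF m]
  proof
    fix j assume j: "j \<in> {1..m}"
    obtain vs bs V where "shadowed m n g xs (packing_of A xs) vs bs V"
      using A(2)[OF xs] unfolding P_def by blast
    note sh = this[unfolded shadowed_def]
    have "bin_load vs bs j \<le> max_load m vs bs" by (rule bin_load_le_max_load[OF j])
    also have "\<dots> \<le> game_value m n vs bs" using sh m by (intro max_load_le_game_value) auto
    also have "\<dots> \<le> lower_bound m n" using sh by blast
    finally have "real n * bin_load vs bs j \<le> real n * lower_bound m n"
      by (simp add: mult_left_mono)
    then have "g * bin_load xs (packing_of A xs) j \<le> real n * lower_bound m n + sqrt g"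
      using sh j by force
    moreover have "(lower_bound m n + sqrt g / real n) * (real n / g) = (real n * lower_bound m n + sqrt g) / g"
      using g granularity_pos by (simp add: distrib_right)
    ultimately show "bin_load xs (packing_of A xs) j \<le> (lower_bound m n + sqrt g / real n) * (real n / g)"
      using g by (simp add: pos_le_divide_eq mult.commute)
  qed
  then have "stretching_factor m A \<le> (lower_bound m n + sqrt g / real n) * (real n / g)"
    unfolding stretching_factor_def using Nil_in_inputs by (intro cSUP_least) auto
  moreover have "opt_stretching m \<le> stretching_factor m A"
    unfolding opt_stretching_def by (rule cINF_lower[OF bdd_below_stretching_factor[OF m] A(1)])
  ultimately show ?thesis by linarith
qed

end

section \<open>Convergence and the explicit error bound\<close>

lemma lower_bound_tendsto_opt_stretching:
  assumes "m \<ge> 1"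
  shows "lower_bound m \<longlonglongrightarrow> opt_stretching m"
proof (rule tendsto_sandwich)
  let ?v = "opt_stretching m"
  \<comment> \<open>As \<open>sqrt (?g n) \<le> sqrt (real n)\<close>, this real scale satisfies
    \<open>?g n + sqrt (?g n) + 1 \<le> real n\<close>, and \<open>?g n / real n\<close> tends to
    1.\<close>
  let ?g = "\<lambda>n. real n - sqrt (real n) - 1"
  have "\<forall>\<^sub>F n in sequentially. 0 < ?g n" by real_asymp
  then show "\<forall>\<^sub>F n in sequentially. ?v * ?g n / real n - sqrt (real n) / real n \<le> lower_bound m n"
  proof eventually_elim
    case (elim n)
    have "0 \<le> sqrt (real n)" by simp
    then have "?g n \<le> real n" and "0 < real n"
      using elim by linarith+
    then have le: "sqrt (?g n) \<le> sqrt (real n)"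
      by (intro real_sqrt_le_mono)
    have "?v \<le> (lower_bound m n + sqrt (?g n) / real n) * (real n / ?g n)"
      using assms elim le by (intro opt_stretching_le_lower_bound) linarith+
    then have "?v * ?g n \<le> lower_bound m n * real n + sqrt (?g n)"
      using elim \<open>0 < real n\<close> by (simp add: divide_simps split: if_splits)
    \<comment> \<open>Passing from \<open>sqrt (?g n)\<close> to \<open>sqrt (real n)\<close> gives
      the lower bound an elementary limit.\<close>
    then have "?v * ?g n - sqrt (real n) \<le> lower_bound m n * real n"
      using le by linarith
    then show ?case
      using \<open>0 < real n\<close> by (simp add: pos_divide_le_eq flip: diff_divide_distrib)
  qed
  show "(\<lambda>n. ?v * ?g n / real n - sqrt (real n) / real n) \<longlonglongrightarrow> ?v"
  proof -
    have "(\<lambda>n. ?g n / real n) \<longlonglongrightarrow> 1" "(\<lambda>n. sqrt (real n) / real n) \<longlonglongrightarrow> 0"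
      by real_asymp+
    from tendsto_diff[OF tendsto_mult[OF tendsto_const[of ?v] this(1)] this(2)]
    show ?thesis by simp
  qed
  show "\<forall>\<^sub>F n in sequentially. lower_bound m n \<le> ?v"
    using lower_bound_le_opt_stretching[OF assms] by simp
qed simp

text \<open>Expanding gives \<open>q = g + m * sqrt g + 1\<close>, so \<open>g'\<close> is a
  granularity large enough for the shadow game at scale \<open>g\<close>, and its error
  \<open>sqrt g\<close> is at most \<open>m * sqrt g + 2\<close>.\<close>

theorem theorem2p4:
  fixes m :: nat
  assumes "m \<ge> 1"
  shows "(\<forall>g::nat. g \<ge> 1 \<longrightarrow>
           (let q = real g * (1 + real m / sqrt (real g) + 1 / real g);
                g' = nat \<lceil>q + sqrt q\<rceil>
            in lower_bound m g' \<le> opt_stretching m \<and>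
               opt_stretching m
                 \<le> (lower_bound m g' + (real m * sqrt (real g) + 2) / real g') * (real g' / real g)))
         \<and> (\<lambda>n. lower_bound m n) \<longlonglongrightarrow> opt_stretching m"
proof (intro conjI allI impI)
  fix g :: nat assume g: "g \<ge> 1"
  define q where "q = real g * (1 + real m / sqrt (real g) + 1 / real g)"
  define g' where "g' = nat \<lceil>q + sqrt q\<rceil>"
  have sqrt_le: "sqrt (real g) \<le> real m * sqrt (real g)"
    using assms by (simp add: mult_le_cancel_right1)
  have "real g / sqrt (real g) = sqrt (real g)"
    by (simp add: real_div_sqrt)
  then have q: "q = real g + real m * sqrt (real g) + 1"
    using g by (simp add: q_def distrib_left) (metis mult.commute times_divide_eq_left)
  then have "0 \<le> sqrt q" by simp
  then have "real g + sqrt (real g) + 1 \<le> real g'"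
    using q sqrt_le unfolding g'_def by linarith
  then have "opt_stretching m \<le> (lower_bound m g' + sqrt (real g) / real g') * (real g' / real g)"
    using assms g by (intro opt_stretching_le_lower_bound) auto
  also have "\<dots> \<le> (lower_bound m g' + (real m * sqrt (real g) + 2) / real g') * (real g' / real g)"
    using sqrt_le by (intro mult_right_mono add_left_mono divide_right_mono) auto
  finally show "let q = real g * (1 + real m / sqrt (real g) + 1 / real g);
                g' = nat \<lceil>q + sqrt q\<rceil>
            in lower_bound m g' \<le> opt_stretching m \<and>
               opt_stretching m
                 \<le> (lower_bound m g' + (real m * sqrt (real g) + 2) / real g') * (real g' / real g)"
    using lower_bound_le_opt_stretching[OF assms] by (simp add: Let_def q_def g'_def)
qed (rule lower_bound_tendsto_opt_stretching[OF assms])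

end
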